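(* Let $M$ be a connected pseudo-Riemannian manifold with isometry group $I(M)$, and let $\Gamma\subset I(M)$ be a discrete subgroup acting properly discontinuously and freely on $M$. If $g\in eN(\Gamma)$ but $g\notin N(\Gamma)$, then the induced map $g_{\#}:M/\Gamma\to M/\Gamma$, $g_{\#}(\Gamma x)=\Gamma(gx)$, is not injective.
   Context: $M/\Gamma$ is the space of orbits $\Gamma x=\{\gamma x\mid\gamma\in\Gamma\}$, $x\in M$. The normalizer of $\Gamma$ in $I(M)$ is $N(\Gamma)=\{g\in I(M)\mid g\Gamma g^{-1}=\Gamma\}$, and the extended normalizer is $eN(\Gamma)=\{g\in I(M)\mid g\Gamma g^{-1}\subset\Gamma\}$ (inclusion not necessarily proper). For $g\in eN(\Gamma)$ the map $g_{\#}$ is well defined on $M/\Gamma$. *)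

theory Defs
  imports
    "HOL-Analysis.Analysis"
    "HOL-Algebra.Bij"
    "HOL-Algebra.Group_Action"
begin

section \<open>Smooth maps between open subsets of normed spaces\<close>

text \<open>Used for open \<open>S\<close> and finite-dimensional domains only. There, continuity of all directional
  derivatives is the same as continuity of the Frechet derivative, so this is the usual \<open>C\<^sup>k\<close>.\<close>

primrec Ck_on ::
  "nat \<Rightarrow> 'b::real_normed_vector set \<Rightarrow> ('b \<Rightarrow> 'c::real_normed_vector) \<Rightarrow> bool" where
  "Ck_on 0 S f \<longleftrightarrow> continuous_on S f"
| "Ck_on (Suc k) S f \<longleftrightarrow>
     (\<forall>x\<in>S. f differentiable (at x)) \<and> (\<forall>v. Ck_on k S (\<lambda>x. frechet_derivative f (at x) v))"

definition smooth_on ::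
  "'b::real_normed_vector set \<Rightarrow> ('b \<Rightarrow> 'c::real_normed_vector) \<Rightarrow> bool" where
  "smooth_on S f \<longleftrightarrow> (\<forall>k. Ck_on k S f)"


section \<open>Smooth manifolds\<close>

text \<open>A chart \<open>(U, \<phi>)\<close> consists of its domain and its coordinate map; the values of \<open>\<phi>\<close> off \<open>U\<close> are
  irrelevant. A tangent vector at \<open>p\<close> is the family of its coordinate vectors, one for each chart
  around \<open>p\<close>, related to each other by the differentials of the coordinate changes. The class
  \<open>euclidean_space\<close> makes the dimension arbitrary but positive; a connected manifold of dimension
  zero is a point.\<close>

type_synonym ('a, 'e) chart = "'a set \<times> ('a \<Rightarrow> 'e)"
type_synonym ('a, 'e) tangent = "('a, 'e) chart \<Rightarrow> 'e"

text \<open>The points of the manifold form the set \<open>topspace (mtop M)\<close>, and \<open>mform M p\<close> is the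
  scalar product on the tangent space at \<open>p\<close>.\<close>

record ('a, 'e) pr_structure =
  mtop :: "'a topology"
  atlas :: "('a, 'e) chart set"
  mform :: "'a \<Rightarrow> ('a, 'e) tangent \<Rightarrow> ('a, 'e) tangent \<Rightarrow> real"

abbreviation points :: "('a, 'e) pr_structure \<Rightarrow> 'a set" where
  "points M \<equiv> topspace (mtop M)"

definition is_chart :: "'a topology \<Rightarrow> ('a, 'e::euclidean_space) chart \<Rightarrow> bool" where
  "is_chart X c \<longleftrightarrow>
     openin X (fst c) \<and> open (snd c ` fst c) \<and>
     homeomorphic_map (subtopology X (fst c)) (top_of_set (snd c ` fst c)) (snd c)"

definition chart_inv :: "('a, 'e) chart \<Rightarrow> 'e \<Rightarrow> 'a" where
  "chart_inv c = inv_into (fst c) (snd c)"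

text \<open>The coordinate expression of \<open>f\<close> in the charts \<open>c\<close> and \<open>d\<close>, defined on \<open>local_dom f c d\<close>.
  For \<open>f = id\<close> this is the change of coordinates from \<open>c\<close> to \<open>d\<close>.\<close>

definition local_repr ::
  "('a \<Rightarrow> 'a) \<Rightarrow> ('a, 'e) chart \<Rightarrow> ('a, 'e) chart \<Rightarrow> 'e \<Rightarrow> 'e" where
  "local_repr f c d = snd d \<circ> f \<circ> chart_inv c"

definition local_dom :: "('a \<Rightarrow> 'a) \<Rightarrow> ('a, 'e) chart \<Rightarrow> ('a, 'e) chart \<Rightarrow> 'e set" where
  "local_dom f c d = snd c ` {x \<in> fst c. f x \<in> fst d}"

definition smooth_manifold :: "('a, 'e::euclidean_space) pr_structure \<Rightarrow> bool" where
  "smooth_manifold M \<longleftrightarrow>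
     Hausdorff_space (mtop M) \<and> second_countable (mtop M) \<and>
     (\<forall>c \<in> atlas M. is_chart (mtop M) c) \<and>
     (\<Union>c \<in> atlas M. fst c) = points M \<and>
     (\<forall>c \<in> atlas M. \<forall>d \<in> atlas M. smooth_on (local_dom id c d) (local_repr id c d))"

definition charts_at :: "('a, 'e) pr_structure \<Rightarrow> 'a \<Rightarrow> ('a, 'e) chart set" where
  "charts_at M p = {c \<in> atlas M. p \<in> fst c}"

definition tangent_space ::
  "('a, 'e::euclidean_space) pr_structure \<Rightarrow> 'a \<Rightarrow> ('a, 'e) tangent set" where
  "tangent_space M p =
     {v. (\<forall>c \<in> charts_at M p. \<forall>d \<in> charts_at M p.
            v d = frechet_derivative (local_repr id c d) (at (snd c p)) (v c)) \<and>
         (\<forall>c. c \<notin> charts_at M p \<longrightarrow> v c = 0)}"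

text \<open>The tangent vector at \<open>p\<close> whose coordinate vector in the chart \<open>c\<close> around \<open>p\<close> is \<open>a\<close>.\<close>

definition coord_vector ::
  "('a, 'e::euclidean_space) pr_structure \<Rightarrow> ('a, 'e) chart \<Rightarrow> 'a \<Rightarrow> 'e \<Rightarrow> ('a, 'e) tangent" where
  "coord_vector M c p a =
     (\<lambda>d. if d \<in> charts_at M p
          then frechet_derivative (local_repr id c d) (at (snd c p)) a else 0)"

definition smooth_self_map :: "('a, 'e::euclidean_space) pr_structure \<Rightarrow> ('a \<Rightarrow> 'a) \<Rightarrow> bool" where
  "smooth_self_map M f \<longleftrightarrow>
     continuous_map (mtop M) (mtop M) f \<and>
     (\<forall>c \<in> atlas M. \<forall>d \<in> atlas M. smooth_on (local_dom f c d) (local_repr f c d))"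

text \<open>For smooth \<open>f\<close> and tangent \<open>v\<close> the result does not depend on the chart picked around \<open>p\<close>.\<close>

definition differential ::
  "('a, 'e::euclidean_space) pr_structure \<Rightarrow> ('a \<Rightarrow> 'a) \<Rightarrow> 'a \<Rightarrow> ('a, 'e) tangent \<Rightarrow> ('a, 'e) tangent"
  where
  "differential M f p v =
     (let c = (SOME c. c \<in> charts_at M p)
      in (\<lambda>d. if d \<in> charts_at M (f p)
              then frechet_derivative (local_repr f c d) (at (snd c p)) (v c) else 0))"


section \<open>Pseudo-Riemannian manifolds and their isometries\<close>

definition scalar_product_on_tangent ::
  "('a, 'e::euclidean_space) pr_structure \<Rightarrow> 'a \<Rightarrow> bool" where
  "scalar_product_on_tangent M p \<longleftrightarrow>
     (\<forall>u \<in> tangent_space M p. \<forall>v \<in> tangent_space M p. mform M p u v = mform M p v u) \<and>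
     (\<forall>u \<in> tangent_space M p. \<forall>v \<in> tangent_space M p. \<forall>w \<in> tangent_space M p. \<forall>a b.
        mform M p (\<lambda>c. a *\<^sub>R u c + b *\<^sub>R v c) w = a * mform M p u w + b * mform M p v w) \<and>
     (\<forall>u \<in> tangent_space M p. (\<forall>w \<in> tangent_space M p. mform M p u w = 0) \<longrightarrow> u = (\<lambda>_. 0))"

text \<open>The index of the scalar products is locally constant by continuity, hence constant if \<open>M\<close> is
  connected.\<close>

definition pseudo_riemannian_manifold :: "('a, 'e::euclidean_space) pr_structure \<Rightarrow> bool" where
  "pseudo_riemannian_manifold M \<longleftrightarrow>
     smooth_manifold M \<and>
     (\<forall>p \<in> points M. scalar_product_on_tangent M p) \<and>
     (\<forall>c \<in> atlas M. \<forall>a b.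
        smooth_on (snd c ` fst c)
          (\<lambda>x. mform M (chart_inv c x)
                 (coord_vector M c (chart_inv c x) a) (coord_vector M c (chart_inv c x) b)))"

definition isometries :: "('a, 'e::euclidean_space) pr_structure \<Rightarrow> ('a \<Rightarrow> 'a) set" where
  "isometries M =
     {f \<in> Bij (points M).
        smooth_self_map M f \<and> smooth_self_map M (\<lambda>x \<in> points M. inv_into (points M) f x) \<and>
        (\<forall>p \<in> points M. \<forall>v \<in> tangent_space M p. \<forall>w \<in> tangent_space M p.
           mform M (f p) (differential M f p v) (differential M f p w) = mform M p v w)}"

definition isometry_group :: "('a, 'e::euclidean_space) pr_structure \<Rightarrow> ('a \<Rightarrow> 'a) monoid" where
  "isometry_group M = (BijGroup (points M))\<lparr>carrier := isometries M\<rparr>"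

text \<open>The Lie group topology of the isometry group is the compact-open topology.\<close>

definition isometry_topology ::
  "('a, 'e::euclidean_space) pr_structure \<Rightarrow> ('a \<Rightarrow> 'a) topology" where
  "isometry_topology M =
     topology_generated_by
       {{f \<in> isometries M. f ` K \<subseteq> U} | K U. compactin (mtop M) K \<and> openin (mtop M) U}"

definition discrete_isometries ::
  "('a, 'e::euclidean_space) pr_structure \<Rightarrow> ('a \<Rightarrow> 'a) set \<Rightarrow> bool" where
  "discrete_isometries M \<Gamma> \<longleftrightarrow> subtopology (isometry_topology M) \<Gamma> = discrete_topology \<Gamma>"

definition acts_properly_discontinuously ::
  "('a, 'e) pr_structure \<Rightarrow> ('a \<Rightarrow> 'a) set \<Rightarrow> bool" where
  "acts_properly_discontinuously M \<Gamma> \<longleftrightarrow>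
     (\<forall>K. compactin (mtop M) K \<longrightarrow> finite {\<gamma> \<in> \<Gamma>. \<gamma> ` K \<inter> K \<noteq> {}})"

definition acts_freely ::
  "('a, 'e::euclidean_space) pr_structure \<Rightarrow> ('a \<Rightarrow> 'a) set \<Rightarrow> bool" where
  "acts_freely M \<Gamma> \<longleftrightarrow>
     (\<forall>\<gamma> \<in> \<Gamma>. \<forall>x \<in> points M. \<gamma> x = x \<longrightarrow> \<gamma> = \<one>\<^bsub>isometry_group M\<^esub>)"


section \<open>Orbit space, extended normalizer and induced map\<close>

definition orbit_of ::
  "('a, 'e::euclidean_space) pr_structure \<Rightarrow> ('a \<Rightarrow> 'a) set \<Rightarrow> 'a \<Rightarrow> 'a set" where
  "orbit_of M \<Gamma> x = orbit ((isometry_group M)\<lparr>carrier := \<Gamma>\<rparr>) (\<lambda>\<gamma>. \<gamma>) x"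

definition orbit_space ::
  "('a, 'e::euclidean_space) pr_structure \<Rightarrow> ('a \<Rightarrow> 'a) set \<Rightarrow> 'a set set" where
  "orbit_space M \<Gamma> = orbits ((isometry_group M)\<lparr>carrier := \<Gamma>\<rparr>) (points M) (\<lambda>\<gamma>. \<gamma>)"

definition extended_normalizer :: "('g, 'm) monoid_scheme \<Rightarrow> 'g set \<Rightarrow> 'g set" where
  "extended_normalizer G H = {g \<in> carrier G. g <#\<^bsub>G\<^esub> H #>\<^bsub>G\<^esub> inv\<^bsub>G\<^esub> g \<subseteq> H}"

text \<open>For \<open>g\<close> in the extended normalizer of \<open>\<Gamma>\<close>, all points of an orbit yield the same value,
  as lemma \<open>induced_map_orbit_of\<close> below confirms.\<close>

definition induced_map ::
  "('a, 'e::euclidean_space) pr_structure \<Rightarrow> ('a \<Rightarrow> 'a) set \<Rightarrow> ('a \<Rightarrow> 'a) \<Rightarrow> 'a set \<Rightarrow> 'a set" where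
  "induced_map M \<Gamma> g X = the_elem ((\<lambda>x. orbit_of M \<Gamma> (g x)) ` X)"

lemma chart_inv_chart:
  assumes "is_chart X c" "x \<in> fst c"
  shows "chart_inv c (snd c x) = x"
proof -
  have "inj_on (snd c) (topspace (subtopology X (fst c)))"
    using assms(1) homeomorphic_imp_injective_map unfolding is_chart_def by blast
  moreover have "topspace (subtopology X (fst c)) = fst c"
    using assms(1) openin_subset unfolding is_chart_def by fastforce
  ultimately show ?thesis
    using assms(2) by (simp add: chart_inv_def)
qed

lemma open_local_dom:
  assumes "is_chart X c" "is_chart X d" "continuous_map X X f"
  shows "open (local_dom f c d)"
proof -
  have eq: "{x \<in> fst c. f x \<in> fst d} = fst c \<inter> {x \<in> topspace X. f x \<in> fst d}"
    using assms(1) openin_subset unfolding is_chart_def by fastforce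
  have "openin X {x \<in> topspace X. f x \<in> fst d}"
    using assms(2,3) unfolding is_chart_def by (simp add: openin_continuous_map_preimage)
  then have "openin (subtopology X (fst c)) {x \<in> fst c. f x \<in> fst d}"
    unfolding eq by (simp add: openin_subtopology_Int2)
  then have "openin (top_of_set (snd c ` fst c)) (snd c ` {x \<in> fst c. f x \<in> fst d})"
    using assms(1) homeomorphic_imp_open_map open_map_def unfolding is_chart_def by blast
  then show ?thesis
    using assms(1) openin_open_trans unfolding local_dom_def is_chart_def by blast
qed

lemma local_repr_chain:
  assumes c: "is_chart X c" "p \<in> fst c" and d: "is_chart X d" "f p \<in> fst d"
    and f: "continuous_map X X f"
    and k: "\<And>x. x \<in> topspace X \<Longrightarrow> k x = h (f x)"
    and df: "local_repr f c d differentiable (at (snd c p))"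
    and dh: "local_repr h d e differentiable (at (snd d (f p)))"
  shows "frechet_derivative (local_repr k c e) (at (snd c p)) v =
         frechet_derivative (local_repr h d e) (at (snd d (f p)))
           (frechet_derivative (local_repr f c d) (at (snd c p)) v)"
proof -
  have fp: "local_repr f c d (snd c p) = snd d (f p)"
    by (simp add: local_repr_def chart_inv_chart[OF c])
  have "(local_repr h d e \<circ> local_repr f c d has_derivative
      frechet_derivative (local_repr h d e) (at (snd d (f p))) \<circ>
      frechet_derivative (local_repr f c d) (at (snd c p))) (at (snd c p))"
    using df dh by (intro diff_chain_at) (simp_all add: fp frechet_derivative_works)
  then have "(local_repr k c e has_derivative
      frechet_derivative (local_repr h d e) (at (snd d (f p))) \<circ>
      frechet_derivative (local_repr f c d) (at (snd c p))) (at (snd c p))"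
  proof (rule has_derivative_transform_within_open)
    show "open (local_dom f c d)" by (rule open_local_dom[OF c(1) d(1) f])
    show "snd c p \<in> local_dom f c d" using c d by (auto simp: local_dom_def)
    show "(local_repr h d e \<circ> local_repr f c d) y = local_repr k c e y"
      if y: "y \<in> local_dom f c d" for y
    proof -
      obtain x where x: "x \<in> fst c" "f x \<in> fst d" "y = snd c x"
        using y unfolding local_dom_def by blast
      moreover have "x \<in> topspace X"
        using x(1) c(1) openin_subset unfolding is_chart_def by blast
      ultimately show ?thesis
        by (simp add: local_repr_def chart_inv_chart[OF c(1)] chart_inv_chart[OF d(1)] k)
    qed
  qed
  then show ?thesis
    by (metis comp_apply frechet_derivative_at)
qed

lemma smooth_on_differentiable: "smooth_on S f \<Longrightarrow> x \<in> S \<Longrightarrow> f differentiable (at x)"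
  unfolding smooth_on_def by (metis Ck_on.simps(2))

lemma isometries_inv:
  assumes M: "smooth_manifold M" and f: "f \<in> isometries M"
  shows "(\<lambda>x \<in> points M. inv_into (points M) f x) \<in> isometries M"
proof -
  let ?S = "points M"
  define h where "h = (\<lambda>x \<in> ?S. inv_into ?S f x)"
  have fB: "f \<in> Bij ?S" and fs: "smooth_self_map M f" and hs: "smooth_self_map M h"
    using f by (auto simp: isometries_def h_def)
  have fbij: "bij_betw f ?S ?S" and fext: "f \<in> extensional ?S"
    using fB by (auto simp: Bij_def)
  have hB: "h \<in> Bij ?S"
    unfolding h_def by (rule restrict_inv_into_Bij[OF fB])
  have hbij: "bij_betw h ?S ?S"
    using hB by (auto simp: Bij_def)
  have fh: "f (h x) = x" if "x \<in> ?S" for x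
    using that fbij by (simp add: h_def bij_betw_inv_into_right)
  have hS: "h x \<in> ?S" if "x \<in> ?S" for x
    using that hbij bij_betwE by blast
  have hh: "(\<lambda>x \<in> ?S. inv_into ?S h x) = f"
  proof (rule extensionalityI[of _ ?S])
    fix x assume x: "x \<in> ?S"
    then have "f x \<in> ?S" "h (f x) = x"
      using fbij by (auto simp: h_def bij_betw_inv_into_left bij_betwE)
    then show "(\<lambda>x \<in> ?S. inv_into ?S h x) x = f x"
      using x hbij by (metis bij_betw_inv_into_left restrict_apply')
  qed (use fext in auto)
  have chart: "is_chart (mtop M) c" if "c \<in> charts_at M p" for c p
    using M that by (auto simp: smooth_manifold_def charts_at_def)
  have at: "p \<in> fst c" if "c \<in> charts_at M p" for c p
    using that by (simp add: charts_at_def)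
  have ex: "\<exists>c. c \<in> charts_at M p" if "p \<in> ?S" for p
    using M that unfolding smooth_manifold_def charts_at_def by blast
  have d_map: "local_repr k c d differentiable (at (snd c p))"
    if "smooth_self_map M k" "c \<in> charts_at M p" "d \<in> charts_at M (k p)" for k c d p
    using that unfolding smooth_self_map_def charts_at_def
    by (auto intro!: smooth_on_differentiable simp: local_dom_def)
  have id_s: "smooth_self_map M id"
    using M by (auto simp: smooth_self_map_def smooth_manifold_def)
  have "mform M (h q) (differential M h q v) (differential M h q w) = mform M q v w"
    if q: "q \<in> ?S" and v: "v \<in> tangent_space M q" and w: "w \<in> tangent_space M q" for q v w
  proof -
    define c where "c = (SOME c. c \<in> charts_at M q)"
    have c: "c \<in> charts_at M q"
      unfolding c_def by (rule someI_ex[OF ex[OF q]])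
    define d where "d = (SOME d. d \<in> charts_at M (h q))"
    have d: "d \<in> charts_at M (h q)"
      unfolding d_def by (rule someI_ex[OF ex[OF hS[OF q]]])
    have hc: "continuous_map (mtop M) (mtop M) h"
      using hs by (simp add: smooth_self_map_def)
    have dh: "differential M h q u e =
        (if e \<in> charts_at M (h q)
         then frechet_derivative (local_repr h c e) (at (snd c q)) (u c) else 0)" for u e
      by (simp add: differential_def c_def Let_def)
    have T: "differential M h q u \<in> tangent_space M (h q)" for u
      unfolding tangent_space_def
    proof (intro CollectI conjI ballI allI impI)
      fix a b assume a: "a \<in> charts_at M (h q)" and b: "b \<in> charts_at M (h q)"
      show "differential M h q u b =
          frechet_derivative (local_repr id a b) (at (snd a (h q))) (differential M h q u a)"
        unfolding dh if_P[OF a] if_P[OF b]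
        by (rule local_repr_chain[OF chart[OF c] at[OF c] chart[OF a] at[OF a] hc])
           (use a b c in \<open>simp_all add: d_map[OF hs] d_map[OF id_s]\<close>)
    qed (simp add: dh)
    have inv: "differential M f (h q) (differential M h q u) = u" if u: "u \<in> tangent_space M q" for u
    proof
      fix e
      show "differential M f (h q) (differential M h q u) e = u e"
      proof (cases "e \<in> charts_at M q")
        case True
        have "differential M f (h q) (differential M h q u) e =
           frechet_derivative (local_repr f d e) (at (snd d (h q)))
             (frechet_derivative (local_repr h c d) (at (snd c q)) (u c))"
          using True d by (simp add: differential_def[of M f] Let_def fh[OF q] dh flip: d_def)
        also have "\<dots> = frechet_derivative (local_repr id c e) (at (snd c q)) (u c)"
          by (rule local_repr_chain[OF chart[OF c] at[OF c] chart[OF d] at[OF d] hc, symmetric])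
             (use True c d in \<open>simp_all add: fh[OF q] fh d_map[OF hs] d_map[OF fs]\<close>)
        also have "\<dots> = u e"
          by (rule sym, use u True c in \<open>unfold tangent_space_def, blast\<close>)
        finally show ?thesis .
      next
        case False
        then have "u e = 0"
          using u unfolding tangent_space_def by blast
        then show ?thesis
          using False by (simp add: differential_def[of M f] Let_def fh[OF q])
      qed
    qed
    have "mform M (f (h q)) (differential M f (h q) (differential M h q v))
        (differential M f (h q) (differential M h q w)) =
      mform M (h q) (differential M h q v) (differential M h q w)"
      using f T hS[OF q] by (auto simp: isometries_def)
    then show ?thesis
      by (simp add: inv v w fh[OF q])
  qed
  then have "h \<in> isometries M"
    using hB hs fs by (auto simp: isometries_def hh)
  then show ?thesis
    by (simp add: h_def)
qed

lemma isometry_group_inv: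
  assumes "smooth_manifold M" "f \<in> isometries M"
  shows "inv\<^bsub>isometry_group M\<^esub> f = (\<lambda>x \<in> points M. inv_into (points M) f x)"
proof -
  let ?S = "points M" and ?h = "\<lambda>x \<in> points M. inv_into (points M) f x"
  interpret B: group "BijGroup ?S" by (rule group_BijGroup)
  have sub: "isometries M \<subseteq> carrier (BijGroup ?S)"
    by (auto simp: isometries_def BijGroup_def)
  have h: "?h \<in> isometries M"
    by (rule isometries_inv[OF assms])
  have hf: "?h \<otimes>\<^bsub>BijGroup ?S\<^esub> f = \<one>\<^bsub>BijGroup ?S\<^esub>"
    using sub assms(2) h by (auto simp: BijGroup_def Bij_compose_restrict_eq isometries_def)
  moreover have "f \<otimes>\<^bsub>BijGroup ?S\<^esub> ?h = \<one>\<^bsub>BijGroup ?S\<^esub>"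
    using hf sub assms(2) h by (meson B.inv_comm subsetD)
  ultimately show ?thesis
    unfolding m_inv_def isometry_group_def
  proof (intro the_equality)
    fix y
    assume y: "y \<in> carrier (BijGroup ?S\<lparr>carrier := isometries M\<rparr>) \<and>
      f \<otimes>\<^bsub>BijGroup ?S\<lparr>carrier := isometries M\<rparr>\<^esub> y = \<one>\<^bsub>BijGroup ?S\<lparr>carrier := isometries M\<rparr>\<^esub> \<and>
      y \<otimes>\<^bsub>BijGroup ?S\<lparr>carrier := isometries M\<rparr>\<^esub> f = \<one>\<^bsub>BijGroup ?S\<lparr>carrier := isometries M\<rparr>\<^esub>"
    have "y \<in> carrier (BijGroup ?S)" "f \<in> carrier (BijGroup ?S)" "?h \<in> carrier (BijGroup ?S)"
      using y h assms(2) sub by auto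
    then show "y = ?h"
      using y hf B.inv_unique by simp metis
  qed (use h in auto)
qed

lemma induced_map_orbit_of:
  assumes M: "smooth_manifold M" and \<Gamma>: "subgroup \<Gamma> (isometry_group M)"
    and g: "g \<in> extended_normalizer (isometry_group M) \<Gamma>" and x: "x \<in> points M"
  shows "induced_map M \<Gamma> g (orbit_of M \<Gamma> x) = orbit_of M \<Gamma> (g x)"
proof -
  let ?S = "points M" and ?I = "isometry_group M"
  let ?h = "\<lambda>x \<in> points M. inv_into (points M) g x"
  have orb: "orbit_of M \<Gamma> y = (\<lambda>\<gamma>. \<gamma> y) ` \<Gamma>" for y
    by (auto simp: orbit_of_def orbit_def)
  have mult: "a \<otimes>\<^bsub>?I\<^esub> b = compose ?S a b" if "a \<in> Bij ?S" "b \<in> Bij ?S" for a b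
    using that by (simp add: isometry_group_def BijGroup_def)
  have gI: "g \<in> isometries M"
    using g by (auto simp: extended_normalizer_def isometry_group_def)
  then have gB: "g \<in> Bij ?S" by (simp add: isometries_def)
  have \<Gamma>B: "\<gamma> \<in> Bij ?S" if "\<gamma> \<in> \<Gamma>" for \<gamma>
    using subgroup.subset[OF \<Gamma>] that by (auto simp: isometry_group_def isometries_def)
  have S: "a y \<in> ?S" if "a \<in> Bij ?S" "y \<in> ?S" for a y
    using that Bij_imp_funcset by blast
  have hB: "?h \<in> Bij ?S"
    by (rule restrict_inv_into_Bij[OF gB])
  have hg: "?h (g y) = y" if "y \<in> ?S" for y
    using that gB S[OF gB that] by (auto simp: Bij_def intro: bij_betw_inv_into_left)
  have conj: "compose ?S (compose ?S g \<gamma>) ?h \<in> \<Gamma>" if "\<gamma> \<in> \<Gamma>" for \<gamma>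
  proof -
    have "g \<otimes>\<^bsub>?I\<^esub> \<gamma> \<otimes>\<^bsub>?I\<^esub> inv\<^bsub>?I\<^esub> g \<in> \<Gamma>"
      using g that by (auto simp: extended_normalizer_def l_coset_def r_coset_def)
    then show ?thesis
      using isometry_group_inv[OF M gI] gB \<Gamma>B[OF that] hB by (simp add: mult compose_Bij)
  qed
  have transl: "orbit_of M \<Gamma> (\<delta> y) = orbit_of M \<Gamma> y" if \<delta>: "\<delta> \<in> \<Gamma>" and y: "y \<in> ?S" for \<delta> y
  proof -
    have 1: "\<gamma> (\<delta> y) \<in> orbit_of M \<Gamma> y" if "\<gamma> \<in> \<Gamma>" "\<delta> \<in> \<Gamma>" "y \<in> ?S" for \<gamma> \<delta> y
    proof -
      have "\<gamma> \<otimes>\<^bsub>?I\<^esub> \<delta> \<in> \<Gamma>" using that \<Gamma> by (simp add: subgroup.m_closed)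
      then have "compose ?S \<gamma> \<delta> \<in> \<Gamma>" using that by (simp add: mult \<Gamma>B)
      moreover have "\<gamma> (\<delta> y) = compose ?S \<gamma> \<delta> y" using that by (simp add: compose_eq)
      ultimately show ?thesis unfolding orb by blast
    qed
    let ?k = "\<lambda>x \<in> ?S. inv_into ?S \<delta> x"
    have "\<delta> \<in> isometries M"
      using subgroup.subset[OF \<Gamma>] \<delta> by (auto simp: isometry_group_def)
    moreover have "inv\<^bsub>?I\<^esub> \<delta> \<in> \<Gamma>"
      using \<Gamma> \<delta> by (rule subgroup.m_inv_closed)
    ultimately have k: "?k \<in> \<Gamma>"
      by (simp add: isometry_group_inv[OF M])
    have "?k (\<delta> y) = y"
      using y \<Gamma>B[OF \<delta>] S[OF \<Gamma>B[OF \<delta>] y] by (auto simp: Bij_def intro: bij_betw_inv_into_left)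
    then have "\<gamma> y \<in> orbit_of M \<Gamma> (\<delta> y)" if "\<gamma> \<in> \<Gamma>" for \<gamma>
      using 1[OF that k S[OF \<Gamma>B[OF \<delta>] y]] by simp
    with 1 \<delta> y show ?thesis by (auto simp: orb)
  qed
  have "orbit_of M \<Gamma> (g (\<gamma> x)) = orbit_of M \<Gamma> (g x)" if \<gamma>: "\<gamma> \<in> \<Gamma>" for \<gamma>
  proof -
    have "compose ?S (compose ?S g \<gamma>) ?h (g x) = g (\<gamma> x)"
      using hg[OF x] S[OF gB x] x by (simp add: compose_eq)
    then show ?thesis
      using transl[OF conj[OF \<gamma>] S[OF gB x]] by simp
  qed
  moreover have "\<Gamma> \<noteq> {}"
    using subgroup.one_closed[OF \<Gamma>] by blast
  ultimately have "(\<lambda>y. orbit_of M \<Gamma> (g y)) ` orbit_of M \<Gamma> x = {orbit_of M \<Gamma> (g x)}"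
    by (auto simp: orb[of x] image_iff)
  then show ?thesis
    by (simp add: induced_map_def)
qed

end

theory Submission
  imports Defs
begin

text \<open>Suppose the induced map is injective and let \<open>\<gamma> \<in> \<Gamma>\<close>. Since \<open>\<gamma> (g x)\<close> lies in the orbit of
  \<open>g x\<close>, the map \<open>h = g\<^sup>-\<^sup>1 \<gamma> g\<close> sends every point \<open>x\<close> into its own orbit, so \<open>h x = \<delta> x\<close> for some
  \<open>\<delta> \<in> \<Gamma>\<close> depending on \<open>x\<close>. The sets \<open>{x. h x = \<delta> x}\<close> are closed, pairwise disjoint because
  \<open>\<Gamma>\<close> acts freely, and locally finite because it acts properly discontinuously; so they are open,
  and by connectedness one of them is everything. Thus \<open>\<gamma> = g \<delta> g\<^sup>-\<^sup>1\<close>, and \<open>g\<close> normalizes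
  \<open>\<Gamma>\<close>.\<close>

lemma pointwise_member_imp_member:
  assumes "connected_space X" "Hausdorff_space X" "locally_compact_space X" "topspace X \<noteq> {}"
    and h: "continuous_map X X h"
    and cont: "\<And>\<delta>. \<delta> \<in> \<Gamma> \<Longrightarrow> continuous_map X X \<delta>"
    and pd: "\<And>K. compactin X K \<Longrightarrow> finite {\<delta> \<in> \<Gamma>. \<delta> ` K \<inter> K \<noteq> {}}"
    and disj: "\<And>\<delta> \<epsilon> x. \<lbrakk>\<delta> \<in> \<Gamma>; \<epsilon> \<in> \<Gamma>; x \<in> topspace X; \<delta> x = \<epsilon> x\<rbrakk> \<Longrightarrow> \<delta> = \<epsilon>"
    and cover: "\<And>x. x \<in> topspace X \<Longrightarrow> \<exists>\<delta>\<in>\<Gamma>. h x = \<delta> x"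
  obtains \<delta> where "\<delta> \<in> \<Gamma>" "\<And>x. x \<in> topspace X \<Longrightarrow> h x = \<delta> x"
proof -
  define A where "A \<delta> = {x \<in> topspace X. h x = \<delta> x}" for \<delta>
  have closed: "closedin X (A \<delta>)" if "\<delta> \<in> \<Gamma>" for \<delta>
    unfolding A_def by (rule closedin_continuous_maps_eq) (use assms(2) h cont that in auto)
  have "openin X (A \<delta>)" if \<delta>: "\<delta> \<in> \<Gamma>" for \<delta>
  proof (subst openin_subopen, intro ballI)
    fix x assume x: "x \<in> A \<delta>"
    then have "x \<in> topspace X" by (simp add: A_def)
    then obtain U K where U: "openin X U" "x \<in> U" "U \<subseteq> K" and K: "compactin X K"
      using assms(3) unfolding locally_compact_space_def by blast
    define F where "F = {\<epsilon> \<in> \<Gamma>. A \<epsilon> \<inter> K \<noteq> {}}"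
    have "compactin X (K \<union> h ` K)"
      using K h by (intro compactin_Un image_compactin)
    then have "finite {\<epsilon> \<in> \<Gamma>. \<epsilon> ` (K \<union> h ` K) \<inter> (K \<union> h ` K) \<noteq> {}}"
      by (rule pd)
    moreover have "\<epsilon> ` (K \<union> h ` K) \<inter> (K \<union> h ` K) \<noteq> {}" if \<epsilon>: "\<epsilon> \<in> F" for \<epsilon>
    proof -
      obtain y where "y \<in> K" "h y = \<epsilon> y"
        using \<epsilon> unfolding F_def A_def by blast
      then have "\<epsilon> y \<in> \<epsilon> ` (K \<union> h ` K)" "\<epsilon> y \<in> K \<union> h ` K"
        by (blast, metis UnI2 imageI)
      then show ?thesis by blast
    qed
    ultimately have "finite F"
      by (elim rev_finite_subset) (auto simp: F_def)
    \<comment> \<open>Only finitely many closed sets are removed, so \<open>V\<close> is open. It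
      keeps \<open>x\<close> because distinct members of \<Gamma> never agree at a point, and
      \<open>cover\<close> leaves its points no set other than \<open>A \<delta>\<close>.\<close>
    define V where "V = U - (\<Union>\<epsilon>\<in>F - {\<delta>}. A \<epsilon>)"
    have "closedin X (\<Union>\<epsilon>\<in>F - {\<delta>}. A \<epsilon>)"
      using \<open>finite F\<close> closed by (intro closedin_Union) (auto simp: F_def)
    then have "openin X V"
      unfolding V_def using U(1) by (rule openin_diff[rotated])
    moreover have "x \<in> V"
      using x U(2) \<delta> disj by (force simp: V_def A_def F_def)
    moreover have "V \<subseteq> A \<delta>"
    proof
      fix y assume y: "y \<in> V"
      then have yX: "y \<in> topspace X" and yK: "y \<in> K"
        using U openin_subset by (auto simp: V_def)
      from cover[OF yX] obtain \<epsilon> where e: "\<epsilon> \<in> \<Gamma>" "h y = \<epsilon> y" by blast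
      with yX yK have "\<epsilon> \<in> F" "y \<in> A \<epsilon>" by (auto simp: F_def A_def)
      with y have "\<epsilon> = \<delta>" by (auto simp: V_def)
      with \<open>y \<in> A \<epsilon>\<close> show "y \<in> A \<delta>" by simp
    qed
    ultimately show "\<exists>T. openin X T \<and> x \<in> T \<and> T \<subseteq> A \<delta>" by blast
  qed
  moreover obtain x \<delta> where "x \<in> topspace X" "\<delta> \<in> \<Gamma>" "h x = \<delta> x"
    using assms(4) cover by blast
  moreover from this have "A \<delta> \<noteq> {}" by (auto simp: A_def)
  ultimately have "A \<delta> = topspace X" "\<delta> \<in> \<Gamma>"
    using assms(1) closed unfolding connected_space_clopen_in by blast+
  with that show ?thesis unfolding A_def by blast
qed

text \<open>A chart domain is homeomorphic to an open subset of Euclidean space. Being open in the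
  manifold, it passes its compact neighbourhoods on to the whole space.\<close>

lemma smooth_manifold_locally_compact:
  assumes "smooth_manifold M"
  shows "locally_compact_space (mtop M)"
  unfolding locally_compact_space_def
proof
  fix x assume "x \<in> points M"
  then obtain c where "c \<in> atlas M" and c: "is_chart (mtop M) c" "x \<in> fst c"
    using assms unfolding smooth_manifold_def by blast
  let ?Y = "subtopology (mtop M) (fst c)"
  have "openin (mtop M) (fst c)" and o: "open (snd c ` fst c)"
    and "homeomorphic_map ?Y (top_of_set (snd c ` fst c)) (snd c)"
    using c by (auto simp: is_chart_def)
  moreover have "locally_compact_space (top_of_set (snd c ` fst c))"
    using o by (intro locally_compact_space_open_subset)
      (auto simp: locally_compact_space_euclidean)
  ultimately have "locally_compact_space ?Y"
    using homeomorphic_locally_compact_space homeomorphic_map_imp_homeomorphic_space by blast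
  moreover have "x \<in> topspace ?Y"
    using c \<open>x \<in> points M\<close> by simp
  ultimately obtain U K where "openin ?Y U" "compactin ?Y K" "x \<in> U" "U \<subseteq> K"
    unfolding locally_compact_space_def by blast
  then show "\<exists>U K. openin (mtop M) U \<and> compactin (mtop M) K \<and> x \<in> U \<and> U \<subseteq> K"
    using \<open>openin (mtop M) (fst c)\<close> by (metis compactin_subtopology openin_trans_full)
qed

text \<open>Lets the group laws of \<open>BijGroup\<close> be used for \<Gamma>. The inverse is a
  definite description over the carrier, so shrinking the carrier might change it; here both
  inverses are the restricted inverse function.\<close>

lemma subgroup_isometry_group_imp_subgroup_BijGroup:
  assumes "smooth_manifold M" "subgroup \<Gamma> (isometry_group M)"
  shows "subgroup \<Gamma> (BijGroup (points M))"
proof -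
  have iso: "\<gamma> \<in> isometries M" if "\<gamma> \<in> \<Gamma>" for \<gamma>
    using subgroup.subset[OF assms(2)] that by (auto simp: isometry_group_def)
  then have bij: "\<gamma> \<in> Bij (points M)" if "\<gamma> \<in> \<Gamma>" for \<gamma>
    using that by (auto simp: isometries_def)
  have "inv\<^bsub>BijGroup (points M)\<^esub> \<gamma> \<in> \<Gamma>" if "\<gamma> \<in> \<Gamma>" for \<gamma>
    using subgroup.m_inv_closed[OF assms(2) that]
    by (simp add: isometry_group_inv[OF assms(1) iso[OF that]] inv_BijGroup[OF bij[OF that]])
  then show ?thesis
    using bij subgroup.m_closed[OF assms(2)] subgroup.one_closed[OF assms(2)]
    by (intro subgroup.intro) (auto simp: isometry_group_def BijGroup_def)
qed

theorem mainTheorem4: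
  fixes M :: "('a, 'e::euclidean_space) pr_structure"
    and \<Gamma> :: "('a \<Rightarrow> 'a) set"
    and g :: "'a \<Rightarrow> 'a"
  assumes "pseudo_riemannian_manifold M"
    and "connected_space (mtop M)"
    and "subgroup \<Gamma> (isometry_group M)"
    and "discrete_isometries M \<Gamma>"
    and "acts_properly_discontinuously M \<Gamma>"
    and "acts_freely M \<Gamma>"
    and "g \<in> extended_normalizer (isometry_group M) \<Gamma>"
    and "g \<notin> normalizer (isometry_group M) \<Gamma>"
  shows "\<not> inj_on (induced_map M \<Gamma> g) (orbit_space M \<Gamma>)"
proof
  assume inj: "inj_on (induced_map M \<Gamma> g) (orbit_space M \<Gamma>)"
  let ?S = "points M" and ?I = "isometry_group M"
  let ?B = "BijGroup ?S" and ?G = "isometry_group M\<lparr>carrier := \<Gamma>\<rparr>"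
  have M: "smooth_manifold M"
    using assms(1) by (simp add: pseudo_riemannian_manifold_def)
  interpret B: group ?B by (rule group_BijGroup)
  have sub: "subgroup \<Gamma> ?B"
    by (rule subgroup_isometry_group_imp_subgroup_BijGroup[OF M assms(3)])
  have G: "?G = ?B\<lparr>carrier := \<Gamma>\<rparr>" by (simp add: isometry_group_def)
  interpret act: group_action ?G ?S "\<lambda>\<gamma>. \<gamma>"
    unfolding G
    by (intro group_action.intro group_hom.intro group_hom_axioms.intro B.group_axioms
        B.subgroup_imp_group[OF sub]) (use subgroup.subset[OF sub] in \<open>auto simp: hom_def\<close>)
  have \<Gamma>B: "\<gamma> \<in> carrier ?B" if "\<gamma> \<in> \<Gamma>" for \<gamma>
    using subgroup.subset[OF sub] that by blast
  have gI: "g \<in> isometries M" and conj_sub: "g <#\<^bsub>?I\<^esub> \<Gamma> #>\<^bsub>?I\<^esub> inv\<^bsub>?I\<^esub> g \<subseteq> \<Gamma>"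
    using assms(7) by (auto simp: extended_normalizer_def isometry_group_def)
  have gBij: "g \<in> Bij ?S"
    using gI by (simp add: isometries_def)
  then have gB: "g \<in> carrier ?B"
    by (simp add: BijGroup_def)
  have inv_g: "inv\<^bsub>?I\<^esub> g = inv\<^bsub>?B\<^esub> g"
    by (simp add: isometry_group_inv[OF M gI] inv_BijGroup[OF gBij])
  have conj: "g <#\<^bsub>?I\<^esub> \<Gamma> #>\<^bsub>?I\<^esub> inv\<^bsub>?I\<^esub> g = (\<lambda>\<delta>. g \<otimes>\<^bsub>?B\<^esub> \<delta> \<otimes>\<^bsub>?B\<^esub> inv\<^bsub>?B\<^esub> g) ` \<Gamma>"
    unfolding inv_g by (auto simp: l_coset_def r_coset_def isometry_group_def)
  \<comment> \<open>\<open>normalizer\<close> is a stabilizer for conjugation restricted to subsets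
    of the carrier, which is why \<Gamma> must be known to be one.\<close>
  have "g <#\<^bsub>?I\<^esub> \<Gamma> #>\<^bsub>?I\<^esub> inv\<^bsub>?I\<^esub> g \<noteq> \<Gamma>"
    using assms(8) gI subgroup.subset[OF assms(3)]
    by (auto simp: normalizer_def stabilizer_def isometry_group_def)
  with conj_sub obtain \<gamma> where \<gamma>: "\<gamma> \<in> \<Gamma>" and
    nconj: "\<And>\<delta>. \<delta> \<in> \<Gamma> \<Longrightarrow> \<gamma> \<noteq> g \<otimes>\<^bsub>?B\<^esub> \<delta> \<otimes>\<^bsub>?B\<^esub> inv\<^bsub>?B\<^esub> g"
    unfolding conj by blast
  \<comment> \<open>As \<gamma> is not a conjugate by \<open>g\<close> of any member of \<Gamma>,
    this \<open>h\<close> lies outside \<Gamma>. The contradiction will be that injectivity forces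
    it inside.\<close>
  define h where "h = inv\<^bsub>?B\<^esub> g \<otimes>\<^bsub>?B\<^esub> \<gamma> \<otimes>\<^bsub>?B\<^esub> g"
  have hB: "h \<in> carrier ?B"
    using gB \<Gamma>B[OF \<gamma>] by (simp add: h_def)
  have hne: "h \<noteq> \<delta>" if "\<delta> \<in> \<Gamma>" for \<delta>
  proof
    assume "h = \<delta>"
    then have "g \<otimes>\<^bsub>?B\<^esub> \<delta> \<otimes>\<^bsub>?B\<^esub> inv\<^bsub>?B\<^esub> g = g \<otimes>\<^bsub>?B\<^esub> h \<otimes>\<^bsub>?B\<^esub> inv\<^bsub>?B\<^esub> g" by simp
    also have "\<dots> = \<gamma>"
      using gB \<Gamma>B[OF \<gamma>]
      by (simp add: h_def B.m_assoc) (simp add: B.m_assoc[symmetric])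
    finally show False using nconj[OF that] by simp
  qed
  \<comment> \<open>Members of \<open>Bij\<close> are extensional, so their values on the points
    determine them.\<close>
  have ext_eq: "a = b" if "a \<in> carrier ?B" "b \<in> carrier ?B" "\<And>x. x \<in> ?S \<Longrightarrow> a x = b x" for a b
    using that by (auto simp: BijGroup_def Bij_def intro: extensionalityI)
  have mult: "(a \<otimes>\<^bsub>?B\<^esub> b) x = a (b x)"
    if "a \<in> carrier ?B" "b \<in> carrier ?B" "x \<in> ?S" for a b x
    using that by (simp add: BijGroup_def compose_eq)
  have S: "a x \<in> ?S" if "a \<in> carrier ?B" "x \<in> ?S" for a x
    using that Bij_imp_funcset by (fastforce simp: BijGroup_def)
  have gh: "g (h x) = \<gamma> (g x)" if x: "x \<in> ?S" for x
  proof -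
    have "g \<otimes>\<^bsub>?B\<^esub> h = \<gamma> \<otimes>\<^bsub>?B\<^esub> g"
      using gB \<Gamma>B[OF \<gamma>] by (simp add: h_def B.m_assoc[symmetric])
    then show ?thesis
      using mult[OF gB hB x] mult[OF \<Gamma>B[OF \<gamma>] gB x] by simp
  qed
  have orbS: "orbit_of M \<Gamma> x \<in> orbit_space M \<Gamma>" if "x \<in> ?S" for x
    using that by (auto simp: orbit_of_def orbit_space_def orbits_def)
  have orb: "orbit_of M \<Gamma> x = (\<lambda>\<delta>. \<delta> x) ` \<Gamma>" for x
    by (auto simp: orbit_of_def orbit_def)
  have refl: "x \<in> orbit_of M \<Gamma> x" if "x \<in> ?S" for x
    using act.orbit_refl[OF that] by (simp add: orbit_of_def)
  \<comment> \<open>Orbits of a group action are equal or disjoint, and these two share the point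
    \<open>\<gamma> y\<close>.\<close>
  have orb_eq: "orbit_of M \<Gamma> (\<gamma> y) = orbit_of M \<Gamma> y" if y: "y \<in> ?S" for y
  proof -
    have "\<gamma> y \<in> orbit_of M \<Gamma> y" "\<gamma> y \<in> orbit_of M \<Gamma> (\<gamma> y)"
      using \<gamma> refl[OF S[OF \<Gamma>B[OF \<gamma>] y]] by (auto simp: orb[of y])
    then show ?thesis
      using act.disjoint_union[of "orbit_of M \<Gamma> (\<gamma> y)" "orbit_of M \<Gamma> y"]
        orbS[OF y] orbS[OF S[OF \<Gamma>B[OF \<gamma>] y]]
      unfolding orbit_space_def by blast
  qed
  \<comment> \<open>By \<open>gh\<close>, the induced map sends the orbits of \<open>h x\<close> and
    \<open>x\<close> to the orbits of \<open>\<gamma> (g x)\<close> and \<open>g x\<close>, which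
    coincide; injectivity then identifies the original orbits.\<close>
  have cover: "\<exists>\<delta>\<in>\<Gamma>. h x = \<delta> x" if x: "x \<in> ?S" for x
  proof -
    note hx = S[OF hB x]
    have "induced_map M \<Gamma> g (orbit_of M \<Gamma> (h x)) = induced_map M \<Gamma> g (orbit_of M \<Gamma> x)"
      by (simp add: induced_map_orbit_of[OF M assms(3,7)] x hx gh orb_eq S[OF gB x])
    then have "orbit_of M \<Gamma> (h x) = orbit_of M \<Gamma> x"
      using inj orbS x hx by (simp add: inj_on_eq_iff)
    with refl[OF hx] show ?thesis by (auto simp: orb)
  qed
  \<comment> \<open>Freeness concerns fixed points only, so it is applied to the quotient of
    \<delta> by \<epsilon>, which fixes \<open>x\<close>.\<close>
  have free: "\<delta> = \<epsilon>" if d: "\<delta> \<in> \<Gamma>" and e: "\<epsilon> \<in> \<Gamma>" and x: "x \<in> ?S" and eq: "\<delta> x = \<epsilon> x" for \<delta> \<epsilon> x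
  proof -
    have "(inv\<^bsub>?B\<^esub> \<epsilon> \<otimes>\<^bsub>?B\<^esub> \<delta>) x = (inv\<^bsub>?B\<^esub> \<epsilon> \<otimes>\<^bsub>?B\<^esub> \<epsilon>) x"
      using \<Gamma>B[OF d] \<Gamma>B[OF e] x eq by (simp add: mult del: B.l_inv B.Units_l_inv)
    also have "\<dots> = x"
      using \<Gamma>B[OF e] x by simp (simp add: BijGroup_def)
    finally have "inv\<^bsub>?B\<^esub> \<epsilon> \<otimes>\<^bsub>?B\<^esub> \<delta> = \<one>\<^bsub>?B\<^esub>"
      using assms(6) x subgroup.m_closed[OF sub subgroup.m_inv_closed[OF sub e] d]
      by (auto simp: acts_freely_def isometry_group_def)
    then show ?thesis
      using \<Gamma>B[OF d] \<Gamma>B[OF e] by (simp add: B.inv_solve_left')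
  qed
  have cont: "continuous_map (mtop M) (mtop M) f" if "f \<in> isometries M" for f
    using that by (simp add: isometries_def smooth_self_map_def)
  have \<Gamma>I: "\<delta> \<in> isometries M" if "\<delta> \<in> \<Gamma>" for \<delta>
    using subgroup.subset[OF assms(3)] that by (auto simp: isometry_group_def)
  \<comment> \<open>Plain composition agrees with the product in \<open>BijGroup\<close> only on the
    points of the manifold, which suffices for continuity.\<close>
  have "continuous_map (mtop M) (mtop M) (inv\<^bsub>?B\<^esub> g \<circ> (\<gamma> \<circ> g))"
    using cont[OF gI] cont[OF \<Gamma>I[OF \<gamma>]] cont[OF isometries_inv[OF M gI]]
    by (intro continuous_map_compose) (simp_all flip: isometry_group_inv[OF M gI] inv_g)
  then have conth: "continuous_map (mtop M) (mtop M) h"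
    by (rule continuous_map_eq) (simp add: h_def mult S gB \<Gamma>B[OF \<gamma>])
  show False
  \<comment> \<open>The empty space counts as connected. On it all members of \<open>Bij\<close>
    coincide, so \<open>h\<close> would be the identity, which belongs to \<Gamma>.\<close>
  proof (cases "?S = {}")
    case True
    then show False
      using hne[OF subgroup.one_closed[OF sub]] ext_eq[OF hB B.one_closed] by blast
  next
    case False
    have haus: "Hausdorff_space (mtop M)"
      using M by (simp add: smooth_manifold_def)
    show False
    proof (rule pointwise_member_imp_member[of "mtop M" h \<Gamma>])
      show "finite {\<delta> \<in> \<Gamma>. \<delta> ` K \<inter> K \<noteq> {}}" if "compactin (mtop M) K" for K
        using assms(5) that by (simp add: acts_properly_discontinuously_def)
      show False if "\<delta> \<in> \<Gamma>" "\<And>x. x \<in> ?S \<Longrightarrow> h x = \<delta> x" for \<delta>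
        using hne[OF that(1)] ext_eq[OF hB \<Gamma>B[OF that(1)] that(2)] by simp
    qed (fact assms(2) haus smooth_manifold_locally_compact[OF M] False conth cont[OF \<Gamma>I]
        free cover)+
  qed
qed

end
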